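(* Let $G=(V,E)$ be a finite digraph and $p\geq 2$ an integer. Then $G$ has a nowhere-zero $p$-flow if and only if there exists a map $\psi:E\to\{0,1,\dots,p-2\}$ such that the number of even $\psi$-conformal dual $p$-flows on $G$ is not equal to the number of odd $\psi$-conformal dual $p$-flows on $G$.
   Context: $\mathbb{Z}_p=\{0,1,\dots,p-1\}$ denotes the additive group of integers modulo $p$. For a vertex $v$, $\delta^-(v)$ is the set of arcs with head $v$ and $\delta^+(v)$ the set of arcs with tail $v$. A $p$-flow on $G$ is a map $\phi:E\to\mathbb{Z}_p$ with $\sum_{e\in\delta^-(v)}\phi(e)-\sum_{e\in\delta^+(v)}\phi(e)=0$ in $\mathbb{Z}_p$ for every vertex $v$; it is nowhere-zero if $\phi(e)\neq 0$ for all $e$. A dual $p$-flow is a map $\phi:E\to\mathbb{Z}_p$ such that for every circuit (cycle) $C$ of the underlying undirected graph, traversed in one of its directions, the signed sum of $\phi(e)$ over $e\in C$ (with sign $+$ for arcs traversed along their orientation and $-$ for arcs traversed against it) is $0$ in $\mathbb{Z}_p$. A map $\phi:E\to\mathbb{Z}_p$ is even if $|\phi^{-1}(p-1)|$ is even, and odd otherwise. For $\psi:E\to\{0,\dots,p-2\}$, a map $\phi:E\to\mathbb{Z}_p$ is $\psi$-conformal if $\phi(e)\in\{\psi(e),p-1\}$ for every arc $e$. *)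

theory Defs
  imports "Graph_Theory.Graph_Theory" "HOL-Number_Theory.Cong" "HOL-Library.FuncSet"
begin

text \<open>
  Elements of \<open>\<int>\<^sub>p\<close> are represented by \<open>{0..<p}\<close>, with equations in \<open>\<int>\<^sub>p\<close> read as
  congruences modulo \<open>p\<close>.  Maps on the arc set are extensional, so that counting
  them counts maps on \<open>arcs G\<close> only.
\<close>

definition Zp_maps :: "('a, 'b) pre_digraph \<Rightarrow> int \<Rightarrow> ('b \<Rightarrow> int) set" where
  "Zp_maps G p = (arcs G \<rightarrow>\<^sub>E {0..<p})"

definition is_flow :: "('a, 'b) pre_digraph \<Rightarrow> int \<Rightarrow> ('b \<Rightarrow> int) \<Rightarrow> bool" where
  "is_flow G p \<phi> \<longleftrightarrow> \<phi> \<in> Zp_maps G p \<and>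
     (\<forall>v \<in> verts G. [(\<Sum>e \<in> in_arcs G v. \<phi> e) - (\<Sum>e \<in> out_arcs G v. \<phi> e) = 0] (mod p))"

definition nowhere_zero :: "('a, 'b) pre_digraph \<Rightarrow> ('b \<Rightarrow> int) \<Rightarrow> bool" where
  "nowhere_zero G \<phi> \<longleftrightarrow> (\<forall>e \<in> arcs G. \<phi> e \<noteq> 0)"

text \<open>
  The two possible traversals of an arc \<open>e\<close>: \<open>(e, True)\<close> runs along its orientation,
  \<open>(e, False)\<close> against it.
\<close>

definition traversals :: "('a, 'b) pre_digraph \<Rightarrow> ('a, 'b \<times> bool) pre_digraph" where
  "traversals G =
     \<lparr> verts = verts G,
       arcs = arcs G \<times> UNIV,
       tail = (\<lambda>(e, fwd). if fwd then tail G e else head G e),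
       head = (\<lambda>(e, fwd). if fwd then head G e else tail G e) \<rparr>"

text \<open>
  A circuit of the underlying undirected multigraph together with a direction (and a
  starting point).  A loop is a circuit of length 1 and two parallel or antiparallel arcs
  form one of length 2; distinctness of the underlying arcs rules out traversing a
  single arc forth and back.
\<close>

definition circuit :: "('a, 'b) pre_digraph \<Rightarrow> ('b \<times> bool) list \<Rightarrow> bool" where
  "circuit G C \<longleftrightarrow> pre_digraph.cycle (traversals G) C \<and> distinct (map fst C)"

definition is_dual_flow :: "('a, 'b) pre_digraph \<Rightarrow> int \<Rightarrow> ('b \<Rightarrow> int) \<Rightarrow> bool" where
  "is_dual_flow G p \<phi> \<longleftrightarrow> \<phi> \<in> Zp_maps G p \<and>
     (\<forall>C. circuit G C \<longrightarrow>
        [(\<Sum>(e, fwd) \<leftarrow> C. if fwd then \<phi> e else - \<phi> e) = 0] (mod p))"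

definition even_map :: "('a, 'b) pre_digraph \<Rightarrow> int \<Rightarrow> ('b \<Rightarrow> int) \<Rightarrow> bool" where
  "even_map G p \<phi> \<longleftrightarrow> even (card {e \<in> arcs G. \<phi> e = p - 1})"

abbreviation odd_map :: "('a, 'b) pre_digraph \<Rightarrow> int \<Rightarrow> ('b \<Rightarrow> int) \<Rightarrow> bool" where
  "odd_map G p \<phi> \<equiv> \<not> even_map G p \<phi>"

definition conformal :: "('a, 'b) pre_digraph \<Rightarrow> int \<Rightarrow> ('b \<Rightarrow> int) \<Rightarrow> ('b \<Rightarrow> int) \<Rightarrow> bool" where
  "conformal G p \<psi> \<phi> \<longleftrightarrow> (\<forall>e \<in> arcs G. \<phi> e \<in> {\<psi> e, p - 1})"

end

theory Submission
  imports Defs Complex_Main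
begin

text \<open>
  Dual flows form a subgroup \<open>D\<close> of \<open>\<int>\<^sub>p\<^sup>E\<close>, namely the coboundaries of vertex potentials,
  and its orthogonal complement consists of the flows. The signed count of \<open>\<psi>\<close>-conformal
  dual flows is the sum over \<open>D\<close> of the product function with factors
  \<open>\<delta>\<^bsub>\<psi>(e)\<^esub> - \<delta>\<^bsub>p-1\<^esub>\<close>. On \<open>\<int>\<^sub>p\<close> the functions \<open>\<delta>\<^bsub>a\<^esub> - \<delta>\<^bsub>p-1\<^esub>\<close> span the functions of
  sum zero, and so do the nontrivial characters. Hence all signed counts vanish if and only if
  the sum over \<open>D\<close> of every product of nontrivial characters vanishes. Such a product is given
  by some \<open>k : E \<rightarrow> \<int>\<^sub>p \<setminus> {0}\<close>, and by orthogonality its sum over \<open>D\<close> is nonzero exactly when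
  \<open>k\<close> is a flow.
\<close>

subsection \<open>Dual flows and potentials\<close>

text \<open>The sum from \<open>is_dual_flow\<close>, named so that it can be computed along walks
  that are not circuits and split at concatenations.\<close>

definition signed_sum :: "('b \<Rightarrow> int) \<Rightarrow> ('b \<times> bool) list \<Rightarrow> int" where
  "signed_sum \<phi> C = (\<Sum>(e, fwd) \<leftarrow> C. if fwd then \<phi> e else - \<phi> e)"

lemma signed_sum_simps [simp]:
  "signed_sum \<phi> [] = 0"
  "signed_sum \<phi> (x # C) = (if snd x then \<phi> (fst x) else - \<phi> (fst x)) + signed_sum \<phi> C"
  "signed_sum \<phi> (C @ D) = signed_sum \<phi> C + signed_sum \<phi> D"
  by (simp_all add: signed_sum_def case_prod_beta)

lemma traversals_simps [simp]:
  "verts (traversals G) = verts G"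
  "arcs (traversals G) = arcs G \<times> UNIV"
  "tail (traversals G) x = (if snd x then tail G (fst x) else head G (fst x))"
  "head (traversals G) x = (if snd x then head G (fst x) else tail G (fst x))"
  by (simp_all add: traversals_def case_prod_beta)

lemma is_dual_flow_iff:
  "is_dual_flow G p \<phi> \<longleftrightarrow>
     \<phi> \<in> Zp_maps G p \<and> (\<forall>C. circuit G C \<longrightarrow> p dvd signed_sum \<phi> C)"
  by (simp add: is_dual_flow_def signed_sum_def cong_0_iff)

lemma (in wf_digraph) wf_digraph_traversals: "wf_digraph (traversals G)"
  by unfold_locales auto

text \<open>Strong induction on length. A repeated vertex splits the walk into two shorter closed
  walks. Without one, the walk is a circuit unless some arc is used twice; that arc is then run in
  both directions, its contributions cancel, and the remaining pieces are again shorter closed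
  walks.\<close>

lemma (in wf_digraph) dvd_signed_sum_closed_walk:
  assumes dual: "is_dual_flow G p \<phi>"
    and "pre_digraph.awalk (traversals G) u C u"
  shows "p dvd signed_sum \<phi> C"
proof -
  interpret T: wf_digraph "traversals G" by (rule wf_digraph_traversals)
  show ?thesis using assms(2)
  proof (induction "length C" arbitrary: u C rule: less_induct)
    case less
    show ?case
    proof (cases C)
      case Nil
      then show ?thesis by simp
    next
      case (Cons x C')
      have walk': "T.awalk (head (traversals G) x) C' u"
        using less.prems unfolding Cons T.awalk_Cons_iff by blast
      show ?thesis
      \<comment> \<open>\<open>tl\<close> drops the start vertex, which necessarily recurs at the
        end of this nonempty closed walk.\<close>
      proof (cases "distinct (tl (T.awalk_verts u C))")
        case False
        then have "\<not> distinct (T.awalk_verts (head (traversals G) x) C')"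
          using Cons by simp
        from T.awalk_not_distinct_decomp[OF walk' this]
        obtain q r s w where C': "C' = q @ r @ s" "r \<noteq> []"
          and walks: "T.awalk (head (traversals G) x) q w" "T.awalk w r w" "T.awalk w s u"
          by auto
        have "T.awalk u (x # q @ s) u"
          using less.prems Cons walks by (auto simp: T.awalk_Cons_iff)
        then have "p dvd signed_sum \<phi> (x # q @ s)"
          using C' Cons by (intro less.hyps) auto
        moreover have "p dvd signed_sum \<phi> r"
          using C' Cons walks by (intro less.hyps) auto
        ultimately have "p dvd signed_sum \<phi> (x # q @ s) + signed_sum \<phi> r"
          by (rule dvd_add)
        then show ?thesis using C' Cons by (simp add: algebra_simps)
      next
        case True
        show ?thesis
        proof (cases "distinct (map fst C)")
          case distinct: True
          have "T.cycle C"
            unfolding T.cycle_def using less.prems True Cons by blast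
          then show ?thesis
            using dual distinct by (simp add: is_dual_flow_iff circuit_def)
        next
          case False
          \<comment> \<open>The traversals end at pairwise distinct vertices, so none of them
            recurs; an arc met twice is therefore met in opposite directions.\<close>
          have distinct: "distinct C"
            using T.distinct_tl_verts_imp_distinct[OF less.prems True] .
          obtain es fs gs e where "map fst C = es @ [e] @ fs @ [e] @ gs"
            using not_distinct_decomp[OF False] by blast
          then obtain q x r y s where C: "C = q @ x # r @ y # s" "fst x = e" "fst y = e"
            by (auto simp: map_eq_append_conv append_eq_map_conv map_eq_Cons_conv Cons_eq_map_conv)
          with distinct have opp: "snd y \<longleftrightarrow> \<not> snd x" by (auto simp: prod_eq_iff)
          then have ends: "head (traversals G) x = tail (traversals G) y"
              "head (traversals G) y = tail (traversals G) x"
            using C by auto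
          have "T.awalk u q (tail (traversals G) x)" "T.awalk (head (traversals G) x) (r @ y # s) u"
            using less.prems unfolding C(1)
            by (auto simp: T.awalk_Cons_iff simp del: traversals_simps)
          moreover from this(2) have walks:
              "T.awalk (tail (traversals G) y) r (tail (traversals G) y)"
              "T.awalk (head (traversals G) y) s u"
            unfolding ends(1) by (auto simp: T.awalk_Cons_iff simp del: traversals_simps)
          ultimately have "T.awalk u (q @ s) u"
            unfolding ends(2) by (metis T.awalk_appendI)
          then have "p dvd signed_sum \<phi> (q @ s)"
            using C by (intro less.hyps) auto
          moreover have "p dvd signed_sum \<phi> r"
            using C by (intro less.hyps[OF _ walks(1)]) auto
          ultimately have "p dvd signed_sum \<phi> (q @ s) + signed_sum \<phi> r"
            by (rule dvd_add)
          then show ?thesis using C opp by (simp add: algebra_simps)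
        qed
      qed
    qed
  qed
qed

section \<open>Reversal of walks, potentials and coboundaries\<close>

definition reverse_walk :: "('b \<times> bool) list \<Rightarrow> ('b \<times> bool) list" where
  "reverse_walk C = rev (map (\<lambda>(e, fwd). (e, \<not> fwd)) C)"

lemma signed_sum_reverse_walk: "signed_sum \<phi> (reverse_walk C) = - signed_sum \<phi> C"
  by (induction C) (auto simp: reverse_walk_def)

lemma (in wf_digraph) awalk_reverse_walk:
  assumes "pre_digraph.awalk (traversals G) u C v"
  shows "pre_digraph.awalk (traversals G) v (reverse_walk C) u"
proof -
  interpret T: wf_digraph "traversals G" by (rule wf_digraph_traversals)
  show ?thesis using assms
  proof (induction C arbitrary: u)
    case Nil
    then show ?case by (auto simp: reverse_walk_def T.awalk_Nil_iff)
  next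
    case (Cons x C)
    then have x: "x \<in> arcs (traversals G)" "u = tail (traversals G) x"
      and "T.awalk v (reverse_walk C) (head (traversals G) x)"
      by (auto simp: T.awalk_Cons_iff)
    moreover have "T.awalk (head (traversals G) x) [(fst x, \<not> snd x)] u"
      using x by (auto simp: T.awalk_simps)
    ultimately have "T.awalk v (reverse_walk C @ [(fst x, \<not> snd x)]) u"
      by (metis T.awalk_appendI)
    then show ?case by (simp add: reverse_walk_def case_prod_beta)
  qed
qed

text \<open>With a root fixed in each component, the potential of a vertex is the signed sum along a
  chosen walk from the root. The walk to the tail of \<open>e\<close>, then \<open>e\<close>, then
  the reversed walk to the head is closed, so its signed sum vanishes modulo
  \<open>p\<close>.\<close>

lemma (in wf_digraph) dual_flow_potential:
  assumes dual: "is_dual_flow G p \<phi>"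
  obtains \<pi> where "\<And>e. e \<in> arcs G \<Longrightarrow> [\<phi> e = \<pi> (head G e) - \<pi> (tail G e)] (mod p)"
proof -
  interpret T: wf_digraph "traversals G" by (rule wf_digraph_traversals)
  \<comment> \<open>The chosen value depends on \<open>v\<close> only through the set of vertices
    from which \<open>v\<close> is reachable. The ends of an arc share this set, hence have the same
    root.\<close>
  define root where "root v = (SOME u. \<exists>C. T.awalk u C v)" for v
  define path where "path v = (SOME C. T.awalk (root v) C v)" for v
  have path: "T.awalk (root v) (path v) v" if "v \<in> verts G" for v
  proof -
    have "\<exists>u C. T.awalk u C v"
      using that by (intro exI[of _ v] exI[of _ "[]"]) (simp add: T.awalk_Nil_iff)
    then have "\<exists>C. T.awalk (root v) C v" unfolding root_def by (rule someI_ex)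
    then show ?thesis unfolding path_def by (rule someI_ex)
  qed
  have "[\<phi> e = signed_sum \<phi> (path (head G e)) - signed_sum \<phi> (path (tail G e))] (mod p)"
    if e: "e \<in> arcs G" for e
  proof -
    have step: "T.awalk (tail G e) [(e, True)] (head G e)"
        "T.awalk (head G e) [(e, False)] (tail G e)"
      using e by (auto simp: T.awalk_simps)
    have "(\<exists>C. T.awalk u C (tail G e)) \<longleftrightarrow> (\<exists>C. T.awalk u C (head G e))" for u
      using step T.awalk_appendI by meson
    then have same: "root (tail G e) = root (head G e)" by (simp add: root_def)
    have "T.awalk (root (tail G e)) (path (tail G e) @ [(e, True)]) (head G e)"
      using path[of "tail G e"] step e by (metis T.awalk_appendI tail_in_verts)
    moreover have "T.awalk (head G e) (reverse_walk (path (head G e))) (root (tail G e))"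
      using path[of "head G e"] e same by (metis awalk_reverse_walk head_in_verts)
    ultimately have "T.awalk (root (tail G e))
        ((path (tail G e) @ [(e, True)]) @ reverse_walk (path (head G e))) (root (tail G e))"
      by (rule T.awalk_appendI)
    from dvd_signed_sum_closed_walk[OF dual this]
    show ?thesis by (simp add: signed_sum_reverse_walk cong_iff_dvd_diff algebra_simps)
  qed
  then show ?thesis by (rule that[of "\<lambda>v. signed_sum \<phi> (path v)"])
qed

text \<open>The signed sum telescopes along a walk to the difference of the potentials at its ends,
  which is zero on a circuit.\<close>

lemma (in wf_digraph) coboundary_is_dual_flow:
  assumes "p > 0"
  shows "is_dual_flow G p (\<lambda>e\<in>arcs G. (\<pi> (head G e) - \<pi> (tail G e)) mod p)"
    (is "is_dual_flow G p ?\<phi>")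
proof -
  interpret T: wf_digraph "traversals G" by (rule wf_digraph_traversals)
  have walk: "[signed_sum ?\<phi> C = \<pi> v - \<pi> u] (mod p)" if "T.awalk u C v" for u C v
    using that
  proof (induction C arbitrary: u)
    case Nil
    then show ?case by (simp add: T.awalk_Nil_iff)
  next
    case (Cons x C)
    have IH: "[signed_sum ?\<phi> C = \<pi> v - \<pi> (head (traversals G) x)] (mod p)"
      using Cons by (auto simp: T.awalk_Cons_iff simp del: restrict_apply traversals_simps)
    have x: "fst x \<in> arcs G" "u = tail (traversals G) x"
      using Cons by (auto simp: T.awalk_Cons_iff)
    have "[(if snd x then ?\<phi> (fst x) else - ?\<phi> (fst x)) =
        \<pi> (head (traversals G) x) - \<pi> u] (mod p)"
      using x by (auto simp: cong_def mod_minus_eq)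
    from cong_add[OF this IH] show ?case by (simp del: restrict_apply)
  qed
  have "p dvd signed_sum ?\<phi> C" if C: "circuit G C" for C
  proof -
    obtain u where "T.awalk u C u"
      using C by (auto simp: circuit_def T.cycle_def)
    from walk[OF this] show ?thesis by (simp add: cong_0_iff)
  qed
  then show ?thesis using assms by (auto simp: is_dual_flow_iff Zp_maps_def)
qed

text \<open>Signed sums are additive modulo \<open>p\<close>. This makes translation by a dual flow
  a self-map of the dual flows, as the character sums below require.\<close>

lemma is_dual_flow_add:
  assumes "is_dual_flow G p \<phi>" "is_dual_flow G p \<phi>'" "p > 0"
  shows "is_dual_flow G p (\<lambda>e\<in>arcs G. (\<phi> e + \<phi>' e) mod p)"
proof -
  let ?s = "\<lambda>e\<in>arcs G. (\<phi> e + \<phi>' e) mod p"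
  have "[signed_sum ?s C = signed_sum \<phi> C + signed_sum \<phi>' C] (mod p)"
    if "fst ` set C \<subseteq> arcs G" for C
    using that
  proof (induction C)
    case (Cons x C)
    have "[(if snd x then ?s (fst x) else - ?s (fst x)) =
        (if snd x then \<phi> (fst x) else - \<phi> (fst x)) + (if snd x then \<phi>' (fst x) else - \<phi>' (fst x))] (mod p)"
      using Cons.prems by (auto simp: cong_def mod_minus_eq)
    moreover have "[signed_sum ?s C = signed_sum \<phi> C + signed_sum \<phi>' C] (mod p)"
      using Cons by (auto simp del: restrict_apply)
    ultimately show ?case
      by (simp only: signed_sum_simps ac_simps) (drule (1) cong_add, simp only: ac_simps)
  qed simp
  moreover have "fst ` set C \<subseteq> arcs G" if "circuit G C" for C
    using that by (auto simp: circuit_def pre_digraph.cycle_def pre_digraph.awalk_def)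
  ultimately have "[signed_sum ?s C = signed_sum \<phi> C + signed_sum \<phi>' C] (mod p)"
    if "circuit G C" for C
    using that by blast
  moreover have "p dvd signed_sum \<phi> C + signed_sum \<phi>' C" if "circuit G C" for C
    using that assms by (simp add: is_dual_flow_iff)
  ultimately have "p dvd signed_sum ?s C" if "circuit G C" for C
    using that cong_dvd_iff by blast
  then show ?thesis using assms by (auto simp: is_dual_flow_iff Zp_maps_def)
qed

section \<open>Orthogonality of flows and dual flows\<close>

text \<open>Summation by parts: the terms are grouped once by the head and once by the tail of the
  arc.\<close>

lemma (in fin_digraph) sum_mult_coboundary:
  fixes k \<pi> :: "_ \<Rightarrow> int"
  shows "(\<Sum>e\<in>arcs G. k e * (\<pi> (head G e) - \<pi> (tail G e))) =
    (\<Sum>v\<in>verts G. \<pi> v * (sum k (in_arcs G v) - sum k (out_arcs G v)))"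
proof -
  have "(\<Sum>v\<in>verts G. \<pi> v * sum k (in_arcs G v)) =
      (\<Sum>v\<in>verts G. \<Sum>e\<in>{e. e \<in> arcs G \<and> head G e = v}. k e * \<pi> (head G e))"
    by (intro sum.cong) (auto simp: in_arcs_def sum_distrib_left mult.commute)
  also have "\<dots> = (\<Sum>e\<in>arcs G. k e * \<pi> (head G e))"
    by (rule sum.group) auto
  finally have "head": "(\<Sum>v\<in>verts G. \<pi> v * sum k (in_arcs G v)) = \<dots>" .
  have "(\<Sum>v\<in>verts G. \<pi> v * sum k (out_arcs G v)) =
      (\<Sum>v\<in>verts G. \<Sum>e\<in>{e. e \<in> arcs G \<and> tail G e = v}. k e * \<pi> (tail G e))"
    by (intro sum.cong) (auto simp: out_arcs_def sum_distrib_left mult.commute)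
  also have "\<dots> = (\<Sum>e\<in>arcs G. k e * \<pi> (tail G e))"
    by (rule sum.group) auto
  finally have "tail": "(\<Sum>v\<in>verts G. \<pi> v * sum k (out_arcs G v)) = \<dots>" .
  show ?thesis
    using "head" "tail" by (simp add: right_diff_distrib sum_subtractf)
qed

text \<open>Dual flows are coboundaries modulo \<open>p\<close>, so summation by parts turns the
  pairing into a combination of the net inflows of \<open>k\<close>. Conversely, suitable
  coboundaries test each net inflow separately.\<close>

lemma (in fin_digraph) flow_iff_orthogonal:
  assumes "p > 0" "k \<in> Zp_maps G p"
  shows "is_flow G p k \<longleftrightarrow> (\<forall>\<phi>. is_dual_flow G p \<phi> \<longrightarrow> p dvd (\<Sum>e\<in>arcs G. k e * \<phi> e))"
proof (intro iffI allI impI)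
  fix \<phi> assume flow: "is_flow G p k" and "is_dual_flow G p \<phi>"
  then obtain \<pi> where \<pi>: "\<And>e. e \<in> arcs G \<Longrightarrow> [\<phi> e = \<pi> (head G e) - \<pi> (tail G e)] (mod p)"
    using dual_flow_potential by blast
  have "[(\<Sum>e\<in>arcs G. k e * \<phi> e) = (\<Sum>e\<in>arcs G. k e * (\<pi> (head G e) - \<pi> (tail G e)))] (mod p)"
    using \<pi> by (intro cong_sum cong_mult) auto
  moreover have "p dvd (\<Sum>v\<in>verts G. \<pi> v * (sum k (in_arcs G v) - sum k (out_arcs G v)))"
    using flow by (intro dvd_sum dvd_mult) (auto simp: is_flow_def cong_0_iff)
  ultimately show "p dvd (\<Sum>e\<in>arcs G. k e * \<phi> e)"
    unfolding sum_mult_coboundary using cong_dvd_iff by blast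
next
  assume orth: "\<forall>\<phi>. is_dual_flow G p \<phi> \<longrightarrow> p dvd (\<Sum>e\<in>arcs G. k e * \<phi> e)"
  have "p dvd sum k (in_arcs G v) - sum k (out_arcs G v)" if v: "v \<in> verts G" for v
  proof -
    \<comment> \<open>Pairing with the coboundary of the indicator of \<open>v\<close> isolates the
      net inflow at \<open>v\<close>.\<close>
    define \<pi> :: "'a \<Rightarrow> int" where "\<pi> w = (if w = v then 1 else 0)" for w
    let ?\<phi> = "\<lambda>e\<in>arcs G. (\<pi> (head G e) - \<pi> (tail G e)) mod p"
    have "p dvd (\<Sum>e\<in>arcs G. k e * ?\<phi> e)"
      using orth coboundary_is_dual_flow[OF \<open>p > 0\<close>] by blast
    moreover have "[(\<Sum>e\<in>arcs G. k e * ?\<phi> e) =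
        (\<Sum>e\<in>arcs G. k e * (\<pi> (head G e) - \<pi> (tail G e)))] (mod p)"
      by (intro cong_sum cong_mult) auto
    ultimately have "p dvd (\<Sum>w\<in>verts G. \<pi> w * (sum k (in_arcs G w) - sum k (out_arcs G w)))"
      unfolding sum_mult_coboundary using cong_dvd_iff by blast
    moreover have "(\<Sum>w\<in>verts G. \<pi> w * (sum k (in_arcs G w) - sum k (out_arcs G w))) =
        (\<Sum>w\<in>verts G. if w = v then sum k (in_arcs G w) - sum k (out_arcs G w) else 0)"
      by (intro sum.cong) (auto simp: \<pi>_def)
    ultimately show ?thesis using v by simp
  qed
  then show "is_flow G p k" using assms by (simp add: is_flow_def cong_0_iff)
qed

subsection \<open>Characters\<close>

text \<open>Since \<open>t\<close> permutes the finite set \<open>A\<close>, reindexing shows that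
  the sum equals \<open>c\<close> times itself. Both vanishing results for character sums rest on
  this.\<close>

lemma sum_eq_0_if_scaled:
  fixes f :: "'c \<Rightarrow> complex"
  assumes "finite A" "t ` A \<subseteq> A" "inj_on t A" "\<And>x. x \<in> A \<Longrightarrow> f (t x) = c * f x" "c \<noteq> 1"
  shows "sum f A = 0"
proof -
  have "t ` A = A" using assms by (intro endo_inj_surj)
  then have "sum f A = sum (f \<circ> t) A"
    using sum.reindex[OF assms(3), of f] by simp
  also have "\<dots> = c * sum f A"
    using assms(4) by (simp add: sum_distrib_left)
  finally show ?thesis using \<open>c \<noteq> 1\<close> by simp
qed

text \<open>The root of unity exp(2 pi i n / p). For positive \<open>p\<close>, the characters of
  the integers modulo \<open>p\<close> are the maps sending \<open>x\<close> to
  \<open>zchar p (k * x)\<close>.\<close>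

definition zchar :: "int \<Rightarrow> int \<Rightarrow> complex" where
  "zchar p n = cis (2 * pi * (real_of_int n / real_of_int p))"

lemma zchar_0 [simp]: "zchar p 0 = 1"
  by (simp add: zchar_def)

lemma zchar_add: "zchar p (m + n) = zchar p m * zchar p n"
  by (simp add: zchar_def cis_mult algebra_simps add_divide_distrib)

lemma zchar_sum: "zchar p (sum f A) = (\<Prod>x\<in>A. zchar p (f x))"
  by (induction A rule: infinite_finite_induct) (simp_all add: zchar_add)

lemma zchar_eq_1_iff:
  assumes "p > 0"
  shows "zchar p n = 1 \<longleftrightarrow> p dvd n"
proof
  assume "zchar p n = 1"
  then have "cos (2 * pi * (real_of_int n / real_of_int p)) = 1"
    by (simp add: zchar_def complex_eq_iff)
  then obtain m :: int where "2 * pi * (real_of_int n / real_of_int p) = real_of_int m * 2 * pi"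
    using cos_one_2pi_int by blast
  then have "real_of_int n = real_of_int m * real_of_int p"
    using assms by (simp add: field_simps)
  then have "n = m * p" by (metis of_int_eq_iff of_int_mult)
  then show "p dvd n" by simp
next
  assume "p dvd n"
  then obtain m where "n = p * m" ..
  then show "zchar p n = 1" using assms by (simp add: zchar_def)
qed

lemma zchar_cong:
  assumes "p > 0" "[m = n] (mod p)"
  shows "zchar p m = zchar p n"
proof -
  have "zchar p m = zchar p n * zchar p (m - n)"
    by (simp flip: zchar_add)
  moreover have "zchar p (m - n) = 1"
    using assms by (simp add: zchar_eq_1_iff cong_iff_dvd_diff)
  ultimately show ?thesis by simp
qed

text \<open>Orthogonality of characters: replacing \<open>k\<close> by \<open>k + 1\<close> modulo
  \<open>p\<close> permutes the terms and multiplies each by \<open>zchar p y\<close>, which differs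
  from 1 unless \<open>p\<close> divides \<open>y\<close>.\<close>

lemma sum_zchar:
  assumes "p > 0"
  shows "(\<Sum>k\<in>{0..<p}. zchar p (k * y)) = (if p dvd y then of_int p else 0)"
proof (cases "p dvd y")
  case True
  then have "zchar p (k * y) = 1" for k using assms by (simp add: zchar_eq_1_iff)
  then show ?thesis using True assms by simp
next
  case False
  have "(\<Sum>k\<in>{0..<p}. zchar p (k * y)) = 0"
  proof (rule sum_eq_0_if_scaled)
    show "inj_on (\<lambda>k. (k + 1) mod p) {0..<p}"
    proof (rule inj_onI)
      fix a b assume "a \<in> {0..<p}" "b \<in> {0..<p}" "(a + 1) mod p = (b + 1) mod p"
      then have "[a = b] (mod p)" by (metis cong_add_rcancel cong_def)
      then show "a = b" using \<open>a \<in> _\<close> \<open>b \<in> _\<close> by (auto simp: cong_def)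
    qed
    show "zchar p ((k + 1) mod p * y) = zchar p y * zchar p (k * y)" for k
    proof -
      have "[(k + 1) mod p * y = y + k * y] (mod p)"
        using cong_mult[of "(k + 1) mod p" "k + 1" p y y] by (simp add: algebra_simps)
      from zchar_cong[OF assms this] show ?thesis by (simp add: zchar_add)
    qed
    show "zchar p y \<noteq> 1" using False assms by (simp add: zchar_eq_1_iff)
  qed (use assms in auto)
  then show ?thesis using False by simp
qed

subsection \<open>Signed counts of conformal maps\<close>

text \<open>For \<open>a\<close> other than \<open>p - 1\<close>, the value 0 rules out nonconformal
  entries and the sign records entries equal to \<open>p - 1\<close>. Values are complex to allow
  linear combinations with characters.\<close>

definition delta_diff :: "int \<Rightarrow> int \<Rightarrow> int \<Rightarrow> complex" where
  "delta_diff p a x = of_bool (x = a) - of_bool (x = p - 1)"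

text \<open>The values of \<open>f\<close> themselves serve as coefficients. At \<open>p - 1\<close>
  the right side is minus the sum of the other values, which is \<open>f (p - 1)\<close> because the
  total is zero.\<close>

lemma sum_zero_expansion:
  assumes "p > 0" "(\<Sum>a\<in>{0..<p}. f a) = 0" "x \<in> {0..<p}"
  shows "f x = (\<Sum>a\<in>{0..p - 2}. f a * delta_diff p a x)"
proof -
  have split: "{0..<p} = insert (p - 1) {0..p - 2}" using assms(1) by auto
  have last: "(\<Sum>a\<in>{0..p - 2}. f a) = - f (p - 1)"
    using assms(2) unfolding split by (simp add: eq_neg_iff_add_eq_0 add.commute)
  show ?thesis
  proof (cases "x = p - 1")
    case True
    have "(\<Sum>a\<in>{0..p - 2}. f a * delta_diff p a x) = (\<Sum>a\<in>{0..p - 2}. - f a)"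
      using True by (intro sum.cong) (auto simp: delta_diff_def)
    then show ?thesis using last True by (simp add: sum_negf)
  next
    case False
    have "(\<Sum>a\<in>{0..p - 2}. f a * delta_diff p a x) = (\<Sum>a\<in>{0..p - 2}. if a = x then f a else 0)"
      using False by (intro sum.cong) (auto simp: delta_diff_def)
    then show ?thesis using False assms(3) by auto
  qed
qed

text \<open>A nontrivial character has sum zero by \<open>sum_zchar\<close>, so
  \<open>sum_zero_expansion\<close> applies.\<close>

lemma zchar_expansion:
  assumes "p > 0" "\<not> p dvd k" "x \<in> {0..<p}"
  shows "zchar p (k * x) = (\<Sum>a\<in>{0..p - 2}. zchar p (k * a) * delta_diff p a x)"
  using sum_zero_expansion[of p "\<lambda>a. zchar p (k * a)" x] sum_zchar[of p k] assms
  by (simp add: mult.commute)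

text \<open>Fourier inversion is applied to both indicators. Their coefficients at
  \<open>k = 0\<close> agree and cancel, so only nontrivial characters remain.\<close>

lemma delta_diff_expansion:
  assumes "p > 0" "x \<in> {0..<p}" "a \<in> {0..<p}"
  shows "delta_diff p a x = (\<Sum>k\<in>{1..<p}.
    (zchar p (k * - a) - zchar p (k * - (p - 1))) / of_int p * zchar p (k * x))"
proof -
  have split: "{0..<p} = insert 0 {1..<p}" using assms(1) by auto
  have delta: "of_bool (x = b) = (\<Sum>k\<in>{0..<p}. zchar p (k * - b) * zchar p (k * x)) / of_int p"
    if "b \<in> {0..<p}" for b
  proof -
    have "p dvd x - b \<longleftrightarrow> x = b"
      using that assms(2) by (metis mod_eq_dvd_iff mod_pos_pos_trivial atLeastLessThan_iff)
    then show ?thesis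
      using sum_zchar[OF assms(1), of "x - b"] assms(1)
      by (simp add: algebra_simps flip: zchar_add)
  qed
  show ?thesis
    using assms unfolding delta_diff_def delta[OF assms(3)]
    by (subst delta, simp) (simp add: split sum_divide_distrib sum_subtractf algebra_simps
        add_divide_distrib diff_divide_distrib)
qed

lemma prod_delta_diff:
  assumes "finite A" "\<And>e. e \<in> A \<Longrightarrow> \<psi> e \<noteq> p - 1"
  shows "(\<Prod>e\<in>A. delta_diff p (\<psi> e) (\<phi> e)) =
    (if \<forall>e\<in>A. \<phi> e \<in> {\<psi> e, p - 1} then (- 1) ^ card {e \<in> A. \<phi> e = p - 1} else 0)"
proof (cases "\<forall>e\<in>A. \<phi> e \<in> {\<psi> e, p - 1}")
  case True
  have "(\<Prod>e\<in>A. delta_diff p (\<psi> e) (\<phi> e)) = (\<Prod>e\<in>A. if \<phi> e = p - 1 then - 1 else 1)"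
    using True assms(2) by (intro prod.cong) (force simp: delta_diff_def)+
  also have "\<dots> = (- 1) ^ card {e \<in> A. \<phi> e = p - 1}"
    using assms(1) by (simp add: prod.If_cases Int_def)
  finally show ?thesis using True by simp
next
  case False
  then obtain e where "e \<in> A" "delta_diff p (\<psi> e) (\<phi> e) = 0"
    by (auto simp: delta_diff_def)
  then show ?thesis using False assms(1) by (metis prod_zero)
qed

lemma finite_dual_flows:
  assumes "finite (arcs G)"
  shows "finite {\<phi>. is_dual_flow G p \<phi>}"
  by (rule finite_subset[of _ "Zp_maps G p"])
    (auto simp: is_dual_flow_def Zp_maps_def assms intro!: finite_PiE)

text \<open>By \<open>prod_delta_diff\<close> each dual flow contributes 1 if it is conformal and
  even, -1 if conformal and odd, and 0 otherwise.\<close>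

lemma signed_count_conformal:
  assumes "finite (arcs G)" "\<psi> \<in> arcs G \<rightarrow>\<^sub>E {0..p - 2}"
  shows "(\<Sum>\<phi> | is_dual_flow G p \<phi>. \<Prod>e\<in>arcs G. delta_diff p (\<psi> e) (\<phi> e)) =
    of_nat (card {\<phi>. is_dual_flow G p \<phi> \<and> conformal G p \<psi> \<phi> \<and> even_map G p \<phi>}) -
    of_nat (card {\<phi>. is_dual_flow G p \<phi> \<and> conformal G p \<psi> \<phi> \<and> odd_map G p \<phi>})"
proof -
  let ?D = "{\<phi>. is_dual_flow G p \<phi>}"
  have fin: "finite ?D" using assms(1) by (rule finite_dual_flows)
  have "\<psi> e \<noteq> p - 1" if "e \<in> arcs G" for e
    using assms(2) that by (fastforce simp: PiE_iff)
  then have "(\<Prod>e\<in>arcs G. delta_diff p (\<psi> e) (\<phi> e)) =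
      of_bool (conformal G p \<psi> \<phi> \<and> even_map G p \<phi>) - of_bool (conformal G p \<psi> \<phi> \<and> odd_map G p \<phi>)" for \<phi>
    using assms(1) by (subst prod_delta_diff) (auto simp: conformal_def even_map_def)
  then show ?thesis
    using fin by (simp add: sum_subtractf flip: Collect_conj_eq)
qed

text \<open>The product is the character of the group of dual flows given by pairing with
  \<open>k\<close>. It is trivial exactly when \<open>k\<close> is a flow; the sum is then the
  number of dual flows, and otherwise zero.\<close>

lemma (in fin_digraph) sum_dual_flows_zchar:
  assumes "p > 0" "k \<in> Zp_maps G p"
  shows "(\<Sum>\<phi> | is_dual_flow G p \<phi>. \<Prod>e\<in>arcs G. zchar p (k e * \<phi> e)) \<noteq> 0 \<longleftrightarrow> is_flow G p k"
proof -
  let ?D = "{\<phi>. is_dual_flow G p \<phi>}" and ?f = "\<lambda>\<phi>. zchar p (\<Sum>e\<in>arcs G. k e * \<phi> e)"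
  have fin: "finite ?D" by (simp add: finite_dual_flows)
  \<comment> \<open>The zero potential provides a dual flow, so the sum of ones is not
    empty.\<close>
  have nonempty: "?D \<noteq> {}"
    using coboundary_is_dual_flow[OF assms(1), of "\<lambda>_. 0"] by blast
  have "sum ?f ?D \<noteq> 0 \<longleftrightarrow> is_flow G p k"
  proof (cases "is_flow G p k")
    case True
    then have "?f \<phi> = 1" if "\<phi> \<in> ?D" for \<phi>
      using that assms by (simp add: flow_iff_orthogonal zchar_eq_1_iff)
    then show ?thesis using True fin nonempty by simp
  next
    case False
    then obtain \<phi>0 where \<phi>0: "is_dual_flow G p \<phi>0" "\<not> p dvd (\<Sum>e\<in>arcs G. k e * \<phi>0 e)"
      using assms by (auto simp: flow_iff_orthogonal)
    \<comment> \<open>Translation by \<open>\<phi>0\<close> multiplies the character by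
      \<open>?f \<phi>0\<close>, which is not 1 by the choice of \<open>\<phi>0\<close>.\<close>
    let ?t = "\<lambda>\<phi>. \<lambda>e\<in>arcs G. (\<phi> e + \<phi>0 e) mod p"
    have "sum ?f ?D = 0"
    proof (rule sum_eq_0_if_scaled)
      show "?t ` ?D \<subseteq> ?D" using is_dual_flow_add \<phi>0(1) assms(1) by blast
      show "inj_on ?t ?D"
      proof (rule inj_onI)
        fix \<phi> \<phi>' assume D: "\<phi> \<in> ?D" "\<phi>' \<in> ?D" and eq: "?t \<phi> = ?t \<phi>'"
        have "\<phi> e = \<phi>' e" if "e \<in> arcs G" for e
        proof -
          have "(\<phi> e + \<phi>0 e) mod p = (\<phi>' e + \<phi>0 e) mod p"
            using fun_cong[OF eq, of e] that by simp
          then have "[\<phi> e = \<phi>' e] (mod p)" by (metis cong_add_rcancel cong_def)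
          moreover have "\<phi> e \<in> {0..<p}" "\<phi>' e \<in> {0..<p}"
            using D that by (auto simp: is_dual_flow_def Zp_maps_def PiE_iff)
          ultimately show ?thesis by (auto simp: cong_def)
        qed
        then show "\<phi> = \<phi>'"
          using D by (auto simp: is_dual_flow_def Zp_maps_def intro: PiE_ext)
      qed
      show "?f (?t \<phi>) = ?f \<phi>0 * ?f \<phi>" for \<phi>
      proof -
        have "[(\<Sum>e\<in>arcs G. k e * ?t \<phi> e) = (\<Sum>e\<in>arcs G. k e * (\<phi>0 e + \<phi> e))] (mod p)"
          by (intro cong_sum cong_mult) (auto simp: cong_def add.commute)
        from zchar_cong[OF assms(1) this] show ?thesis
          by (simp add: distrib_left sum.distrib zchar_add)
      qed
      show "?f \<phi>0 \<noteq> 1" using \<phi>0(2) assms(1) by (simp add: zchar_eq_1_iff)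
    qed (rule fin)
    then show ?thesis using False by simp
  qed
  then show ?thesis by (simp add: zchar_sum)
qed

text \<open>Multiplying out and exchanging sums writes the nonzero total as a linear combination of
  the totals for the choices \<open>h\<close>, so one of these is nonzero. This passes between
  characters and \<open>delta_diff\<close> in either direction.\<close>

lemma sum_prod_expansion_nonzero:
  fixes f :: "'e \<Rightarrow> 'c \<Rightarrow> complex"
  assumes fin: "finite A" "\<And>e. e \<in> A \<Longrightarrow> finite (B e)"
    and f: "\<And>\<phi> e. \<phi> \<in> D \<Longrightarrow> e \<in> A \<Longrightarrow> f e (\<phi> e) = (\<Sum>b\<in>B e. c e b * g b (\<phi> e))"
    and nz: "(\<Sum>\<phi>\<in>D. \<Prod>e\<in>A. f e (\<phi> e)) \<noteq> 0"
  obtains h where "h \<in> PiE A B" "(\<Sum>\<phi>\<in>D. \<Prod>e\<in>A. g (h e) (\<phi> e)) \<noteq> 0"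
proof -
  have "(\<Sum>\<phi>\<in>D. \<Prod>e\<in>A. f e (\<phi> e)) = (\<Sum>\<phi>\<in>D. \<Prod>e\<in>A. \<Sum>b\<in>B e. c e b * g b (\<phi> e))"
    using f by (intro sum.cong prod.cong) auto
  also have "\<dots> = (\<Sum>\<phi>\<in>D. \<Sum>h\<in>PiE A B. (\<Prod>e\<in>A. c e (h e)) * (\<Prod>e\<in>A. g (h e) (\<phi> e)))"
    using fin by (simp add: prod_sum_PiE prod.distrib)
  also have "\<dots> = (\<Sum>h\<in>PiE A B. (\<Prod>e\<in>A. c e (h e)) * (\<Sum>\<phi>\<in>D. \<Prod>e\<in>A. g (h e) (\<phi> e)))"
    by (subst sum.swap) (simp add: sum_distrib_left)
  finally have "\<exists>h\<in>PiE A B. (\<Sum>\<phi>\<in>D. \<Prod>e\<in>A. g (h e) (\<phi> e)) \<noteq> 0"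
    using nz by (metis (no_types, lifting) mult_zero_right sum.neutral)
  then show ?thesis using that by blast
qed

theorem theorem1p2:
  fixes G :: "('a, 'b) pre_digraph" and p :: int
  assumes "fin_digraph G" and "p \<ge> 2"
  shows "(\<exists>\<phi>. is_flow G p \<phi> \<and> nowhere_zero G \<phi>) \<longleftrightarrow>
    (\<exists>\<psi> \<in> arcs G \<rightarrow>\<^sub>E {0..p - 2}.
       card {\<phi>. is_dual_flow G p \<phi> \<and> conformal G p \<psi> \<phi> \<and> even_map G p \<phi>}
       \<noteq> card {\<phi>. is_dual_flow G p \<phi> \<and> conformal G p \<psi> \<phi> \<and> odd_map G p \<phi>})"
proof -
  interpret fin_digraph G by fact
  have p: "p > 0" using assms(2) by simp
  let ?D = "{\<phi>. is_dual_flow G p \<phi>}"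
  have range: "\<phi> e \<in> {0..<p}" if "\<phi> \<in> ?D" "e \<in> arcs G" for \<phi> e
    using that by (auto simp: is_dual_flow_def Zp_maps_def PiE_iff)
  have signed_count: "card {\<phi>. is_dual_flow G p \<phi> \<and> conformal G p \<psi> \<phi> \<and> even_map G p \<phi>}
       \<noteq> card {\<phi>. is_dual_flow G p \<phi> \<and> conformal G p \<psi> \<phi> \<and> odd_map G p \<phi>} \<longleftrightarrow>
      (\<Sum>\<phi>\<in>?D. \<Prod>e\<in>arcs G. delta_diff p (\<psi> e) (\<phi> e)) \<noteq> 0"
    if "\<psi> \<in> arcs G \<rightarrow>\<^sub>E {0..p - 2}" for \<psi>
    using signed_count_conformal[OF finite_arcs that] by simp
  show ?thesis
  proof
    assume "\<exists>k. is_flow G p k \<and> nowhere_zero G k"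
    then obtain k where k: "is_flow G p k" "nowhere_zero G k" by blast
    then have Zp: "k \<in> Zp_maps G p" by (simp add: is_flow_def)
    \<comment> \<open>Being nowhere zero makes the character at every arc nontrivial, hence
      expandable in the functions \<open>delta_diff p a\<close>.\<close>
    have ndvd: "\<not> p dvd k e" if "e \<in> arcs G" for e
    proof -
      have "0 < k e" "k e < p"
        using Zp k(2) that by (force simp: Zp_maps_def PiE_iff nowhere_zero_def)+
      then show ?thesis by (simp add: zdvd_not_zless)
    qed
    have nz: "(\<Sum>\<phi>\<in>?D. \<Prod>e\<in>arcs G. zchar p (k e * \<phi> e)) \<noteq> 0"
      using sum_dual_flows_zchar[OF p Zp] k(1) by simp
    have "zchar p (k e * \<phi> e) =
        (\<Sum>a\<in>{0..p - 2}. zchar p (k e * a) * delta_diff p a (\<phi> e))"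
      if "\<phi> \<in> ?D" "e \<in> arcs G" for \<phi> e
      using that by (intro zchar_expansion p ndvd range)
    then obtain \<psi> where "\<psi> \<in> arcs G \<rightarrow>\<^sub>E {0..p - 2}"
        "(\<Sum>\<phi>\<in>?D. \<Prod>e\<in>arcs G. delta_diff p (\<psi> e) (\<phi> e)) \<noteq> 0"
      using nz by (rule sum_prod_expansion_nonzero
        [where f = "\<lambda>e x. zchar p (k e * x)" and c = "\<lambda>e a. zchar p (k e * a)"
           and g = "delta_diff p" and B = "\<lambda>_. {0..p - 2}", OF finite_arcs, rotated]) auto
    then show "\<exists>\<psi> \<in> arcs G \<rightarrow>\<^sub>E {0..p - 2}.
       card {\<phi>. is_dual_flow G p \<phi> \<and> conformal G p \<psi> \<phi> \<and> even_map G p \<phi>}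
       \<noteq> card {\<phi>. is_dual_flow G p \<phi> \<and> conformal G p \<psi> \<phi> \<and> odd_map G p \<phi>}"
      using signed_count by blast
  next
    assume "\<exists>\<psi> \<in> arcs G \<rightarrow>\<^sub>E {0..p - 2}.
       card {\<phi>. is_dual_flow G p \<phi> \<and> conformal G p \<psi> \<phi> \<and> even_map G p \<phi>}
       \<noteq> card {\<phi>. is_dual_flow G p \<phi> \<and> conformal G p \<psi> \<phi> \<and> odd_map G p \<phi>}"
    then obtain \<psi> where \<psi>: "\<psi> \<in> arcs G \<rightarrow>\<^sub>E {0..p - 2}"
        "(\<Sum>\<phi>\<in>?D. \<Prod>e\<in>arcs G. delta_diff p (\<psi> e) (\<phi> e)) \<noteq> 0"
      using signed_count by blast
    have \<psi>_range: "\<psi> e \<in> {0..<p}" if "e \<in> arcs G" for e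
      using \<psi>(1) that by (fastforce simp: PiE_iff)
    \<comment> \<open>In this direction the index set \<open>{1..<p}\<close> of the characters omits
      0, so the choice function obtained from it is nowhere zero.\<close>
    have "delta_diff p (\<psi> e) (\<phi> e) = (\<Sum>k\<in>{1..<p}.
        (zchar p (k * - \<psi> e) - zchar p (k * - (p - 1))) / of_int p * zchar p (k * \<phi> e))"
      if "\<phi> \<in> ?D" "e \<in> arcs G" for \<phi> e
      using that by (intro delta_diff_expansion p range \<psi>_range)
    then obtain k where k: "k \<in> arcs G \<rightarrow>\<^sub>E {1..<p}"
        "(\<Sum>\<phi>\<in>?D. \<Prod>e\<in>arcs G. zchar p (k e * \<phi> e)) \<noteq> 0"
      using \<psi>(2) by (rule sum_prod_expansion_nonzero
        [where f = "\<lambda>e. delta_diff p (\<psi> e)" and g = "\<lambda>k x. zchar p (k * x)"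
           and c = "\<lambda>e k. (zchar p (k * - \<psi> e) - zchar p (k * - (p - 1))) / of_int p"
           and B = "\<lambda>_. {1..<p}", OF finite_arcs, rotated]) auto
    have "k \<in> Zp_maps G p" using k(1) by (force simp: Zp_maps_def PiE_iff)
    with k(2) have "is_flow G p k" using sum_dual_flows_zchar[OF p] by blast
    moreover have "nowhere_zero G k" using k(1) by (force simp: nowhere_zero_def PiE_iff)
    ultimately show "\<exists>k. is_flow G p k \<and> nowhere_zero G k" by blast
  qed
qed

end
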